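(* Let $w_{012}(n)$ be the number of weak ascent sequences of length $n$ that avoid the pattern $012$, and let $F_{012}(x)=\sum_{n\ge 0} w_{012}(n)\,x^n$. Then, as formal power series, $$F_{012}(x)=\frac{1-2x}{1-3x+x^2}.$$
   Context: For a word $u=u_1\cdots u_\ell$ of non-negative integers, $\mathrm{wasc}(u)$ denotes the number of weak ascents of $u$, i.e. the number of positions $j$ with $1\le j\le \ell-1$ and $u_j\le u_{j+1}$. A weak ascent sequence of length $n\ge 1$ is a word $w=w_1w_2\cdots w_n$ of non-negative integers with $w_1=0$ and $w_i\le \mathrm{wasc}(w_1\cdots w_{i-1})+1$ for $i=2,\dots,n$; the empty word is the unique weak ascent sequence of length $0$ (and it avoids every nonempty pattern). The word $w$ contains a pattern $p=p_1\cdots p_k$ if there are indices $i_1<\cdots<i_k$ such that $w_{i_1}\cdots w_{i_k}$ is order-isomorphic to $p$ (for all $a,b$: $w_{i_a}<w_{i_b}$ iff $p_a<p_b$, and $w_{i_a}=w_{i_b}$ iff $p_a=p_b$); otherwise $w$ avoids $p$. *)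

theory Defs
  imports "HOL-Computational_Algebra.Formal_Power_Series"
begin

text \<open>
  Words of non-negative integers are lists of type \<^typ>\<open>nat list\<close>. List positions are counted
  from \<open>0\<close>, so the letter \<open>w_i\<close> of the usual notation is \<open>w ! (i - 1)\<close>.
\<close>

definition wasc :: "nat list \<Rightarrow> nat" where
  "wasc u = card {j. Suc j < length u \<and> u ! j \<le> u ! Suc j}"

definition weak_ascent_seq :: "nat list \<Rightarrow> bool" where
  "weak_ascent_seq w \<longleftrightarrow>
     w = [] \<or>
     (w ! 0 = 0 \<and> (\<forall>i. 1 \<le> i \<and> i < length w \<longrightarrow> w ! i \<le> wasc (take i w) + 1))"

definition order_isomorphic :: "nat list \<Rightarrow> nat list \<Rightarrow> bool" where
  "order_isomorphic u p \<longleftrightarrow>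
     length u = length p \<and>
     (\<forall>a < length p. \<forall>b < length p.
        (u ! a < u ! b \<longleftrightarrow> p ! a < p ! b) \<and> (u ! a = u ! b \<longleftrightarrow> p ! a = p ! b))"

text \<open>
  The function \<open>f\<close> lists the positions \<open>i_1 < ... < i_k\<close> of an occurrence of the pattern;
  only its values on \<open>{..<length p}\<close> matter.
\<close>

definition contains_pattern :: "nat list \<Rightarrow> nat list \<Rightarrow> bool" where
  "contains_pattern w p \<longleftrightarrow>
     (\<exists>f :: nat \<Rightarrow> nat.
        strict_mono_on {..<length p} f \<and>
        (\<forall>a < length p. f a < length w) \<and>
        order_isomorphic (map (\<lambda>a. w ! f a) [0..<length p]) p)"

definition avoids :: "nat list \<Rightarrow> nat list \<Rightarrow> bool" where
  "avoids w p \<longleftrightarrow> \<not> contains_pattern w p"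

definition avoiding_weak_ascent_seqs :: "nat list \<Rightarrow> nat \<Rightarrow> nat list set" where
  "avoiding_weak_ascent_seqs p n = {w. length w = n \<and> weak_ascent_seq w \<and> avoids w p}"

definition num_avoiding :: "nat list \<Rightarrow> nat \<Rightarrow> nat" where
  "num_avoiding p n = card (avoiding_weak_ascent_seqs p n)"

text \<open>Rational coefficients are used so that division of power series is available.\<close>

definition gen_fun_avoiding :: "nat list \<Rightarrow> rat fps" where
  "gen_fun_avoiding p = Abs_fps (\<lambda>n. of_nat (num_avoiding p n))"

end

theory Submission
  imports Defs
begin

text \<open>
  A weak ascent sequence starts with \<open>0\<close>, so it avoids \<open>012\<close> iff its nonzero letters are
  weakly decreasing. If it begins with exactly \<open>k\<close> zeros, the only effective growth condition
  is that the first nonzero letter is at most \<open>k\<close>: later letters are no larger, while the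
  number of weak ascents of the prefixes stays at least \<open>k - 1\<close>.
  Let \<open>D a\<close> be the generating function of the words over \<open>{0..a}\<close> with weakly decreasing
  nonzero letters, and \<open>C k\<close> that of the admissible continuations of \<open>k\<close> zeros. Looking at the
  first letter gives \<open>(1 - 2x) D (a+1) = (1 - x) D a\<close> and \<open>C k = x C (k+1) + (1 - x) D k\<close>.
  With \<open>r = (1 - x) / (1 - 2x)\<close> the solution is \<open>C k = r^k / (1 - x r)\<close>, and the series sought
  is \<open>1 + x C 1\<close>.
\<close>

section \<open>Avoidance of 012 behind leading zeros\<close>

text \<open>The relation is not transitive: it holds for (1, 0) and (0, 2) but not for (1, 2). As
  \<open>sorted_wrt\<close> compares all pairs, nonzero letters are compared across zeros
  too.\<close>

abbreviation nonzero_decr :: "nat list \<Rightarrow> bool" where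
  "nonzero_decr \<equiv> sorted_wrt (\<lambda>a b. a = 0 \<or> b \<le> a)"

lemma order_isomorphic_012:
  "order_isomorphic [a, b, c] [0, 1, 2] \<longleftrightarrow> a < b \<and> b < c"
  unfolding order_isomorphic_def
  by (auto simp: All_less_Suc2 numeral_3_eq_3 nth_Cons')

lemma contains_012_iff:
  "contains_pattern w [0, 1, 2] \<longleftrightarrow>
     (\<exists>i j l. i < j \<and> j < l \<and> l < length w \<and> w ! i < w ! j \<and> w ! j < w ! l)"
proof
  assume "contains_pattern w [0, 1, 2]"
  then obtain f :: "nat \<Rightarrow> nat" where f: "strict_mono_on {..<3} f" "\<forall>a < 3. f a < length w"
    "order_isomorphic (map (\<lambda>a. w ! f a) [0..<3]) [0, 1, 2]"
    unfolding contains_pattern_def by (auto simp: numeral_3_eq_3)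
  have upt3: "[0..<3] = [0, 1, 2::nat]" by (simp add: upt_rec)
  have "f 0 < f 1" "f 1 < f 2" using f(1) by (auto simp: strict_mono_on_def)
  moreover have "w ! f 0 < w ! f 1" "w ! f 1 < w ! f 2"
    using f(3) unfolding upt3 list.map order_isomorphic_012 by auto
  moreover have "f 2 < length w" using f(2) by auto
  ultimately show "\<exists>i j l. i < j \<and> j < l \<and> l < length w \<and> w ! i < w ! j \<and> w ! j < w ! l"
    by blast
next
  assume "\<exists>i j l. i < j \<and> j < l \<and> l < length w \<and> w ! i < w ! j \<and> w ! j < w ! l"
  then obtain i j l where ijl: "i < j" "j < l" "l < length w" "w ! i < w ! j" "w ! j < w ! l"
    by blast
  define f where "f = (!) [i, j, l]"
  have len: "length [0, 1, 2 :: nat] = 3" by simp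
  have upt3: "[0..<3] = [0, 1, 2::nat]" by (simp add: upt_rec)
  have less3: "a < 3 \<longleftrightarrow> a = 0 \<or> a = 1 \<or> a = 2" for a :: nat by auto
  have "strict_mono_on {..<3} f"
    using ijl by (auto simp: strict_mono_on_def less3 f_def)
  moreover have "\<forall>a<3. f a < length w"
    using ijl by (auto simp: less3 f_def)
  moreover have "order_isomorphic (map (\<lambda>a. w ! f a) [0..<3]) [0, 1, 2]"
    unfolding upt3 list.map order_isomorphic_012 using ijl by (simp add: f_def)
  ultimately show "contains_pattern w [0, 1, 2]"
    unfolding contains_pattern_def len by blast
qed

text \<open>The leading 0 lies below every nonzero letter, so it completes each ascent between
  nonzero letters of \<open>v\<close> to an occurrence of 012.\<close>

lemma avoids_012_Cons_0_iff: "avoids (0 # v) [0, 1, 2] \<longleftrightarrow> nonzero_decr v"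
proof
  assume av: "avoids (0 # v) [0, 1, 2]"
  show "nonzero_decr v"
    unfolding sorted_wrt_iff_nth_less
  proof (intro allI impI)
    fix i j assume "i < j" "j < length v"
    then have "\<not> ((0 # v) ! 0 < (0 # v) ! Suc i \<and> (0 # v) ! Suc i < (0 # v) ! Suc j)"
      using av unfolding avoids_def contains_012_iff
      by (metis Suc_less_eq length_Cons zero_less_Suc)
    then show "v ! i = 0 \<or> v ! j \<le> v ! i"
      by auto
  qed
next
  assume decr: "nonzero_decr v"
  show "avoids (0 # v) [0, 1, 2]"
    unfolding avoids_def contains_012_iff
  proof clarify
    fix i j l
    assume ijl: "i < j" "j < l" "l < length (0 # v)" "(0 # v) ! i < (0 # v) ! j"
      "(0 # v) ! j < (0 # v) ! l"
    \<comment> \<open>Positions \<open>j\<close> and \<open>l\<close> exceed \<open>i\<close>, so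
      both fall into \<open>v\<close>; the letter at \<open>j\<close> exceeds another one, hence is
      nonzero.\<close>
    then obtain j' l' where "j = Suc j'" "l = Suc l'"
      by (cases j; cases l) auto
    with ijl sorted_wrt_nth_less[OF decr, of j' l'] show False
      by auto
  qed
qed

lemma avoids_012_replicate_0_iff:
  assumes "k > 0"
  shows "avoids (replicate k 0 @ v) [0, 1, 2] \<longleftrightarrow> nonzero_decr v"
proof -
  obtain k' where "k = Suc k'" using assms by (cases k) auto
  then show ?thesis
    by (simp add: avoids_012_Cons_0_iff[simplified] sorted_wrt_append sorted_wrt_iff_nth_less[of _ "replicate k' 0"])
qed

section \<open>Weak ascents and the growth condition\<close>

lemma wasc_append_ge: "wasc u \<le> wasc (u @ v)"
  unfolding wasc_def
proof (rule card_mono)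
  show "finite {j. Suc j < length (u @ v) \<and> (u @ v) ! j \<le> (u @ v) ! Suc j}"
    by (rule finite_subset[of _ "{..<length (u @ v)}"]) auto
qed (auto simp: nth_append)

lemma wasc_replicate: "wasc (replicate k a) = k - 1"
proof -
  have "{j. Suc j < k \<and> replicate k a ! j \<le> replicate k a ! Suc j} = {..<k - 1}"
    by auto
  then show ?thesis unfolding wasc_def by simp
qed

lemma weak_ascent_seq_replicate_0: "weak_ascent_seq (replicate k 0)"
  unfolding weak_ascent_seq_def by (cases k) auto

lemma weak_ascent_seq_replicate_0_Cons_iff:
  assumes "k > 0" "x > 0" "\<forall>y\<in>set v. y \<le> x"
  shows "weak_ascent_seq (replicate k 0 @ x # v) \<longleftrightarrow> x \<le> k"
proof
  assume "weak_ascent_seq (replicate k 0 @ x # v)"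
  \<comment> \<open>Position \<open>k\<close> carries the first nonzero letter; the \<open>k\<close>
    zeros before it give \<open>k - 1\<close> weak ascents, so the bound there is exactly
    \<open>k\<close>.\<close>
  then have "(replicate k 0 @ x # v) ! k \<le> wasc (take k (replicate k 0 @ x # v)) + 1"
    unfolding weak_ascent_seq_def using assms by (simp del: take_append)
  then show "x \<le> k"
    using assms by (simp add: nth_append wasc_replicate)
next
  assume "x \<le> k"
  let ?w = "replicate k 0 @ x # v"
  have "?w ! i \<le> wasc (take i ?w) + 1" if "i < length ?w" for i
  proof (cases "i < k")
    case False
    \<comment> \<open>From position \<open>k\<close> on, the prefix contains all \<open>k\<close>
      zeros, which alone secure the bound \<open>k\<close>.\<close>
    have "k \<le> wasc (replicate k (0::nat)) + 1"
      by (simp add: wasc_replicate)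
    also have "\<dots> \<le> wasc (take i ?w) + 1"
      using False wasc_append_ge[of "replicate k 0" "take (i - k) (x # v)"] by simp
    finally have "k \<le> wasc (take i ?w) + 1" .
    moreover have "(x # v) ! (i - k) \<in> set (x # v)"
      using that False by (intro nth_mem) auto
    then have "?w ! i \<le> x"
      using False assms(3) by (auto simp: nth_append)
    ultimately show ?thesis using \<open>x \<le> k\<close> by simp
  qed (simp add: nth_append)
  then show "weak_ascent_seq ?w"
    unfolding weak_ascent_seq_def using assms(1) by (simp add: nth_append)
qed

section \<open>Decomposition by the first letter\<close>

definition capped_words :: "nat \<Rightarrow> nat \<Rightarrow> nat list set" where
  "capped_words a m = {v. length v = m \<and> set v \<subseteq> {..a} \<and> nonzero_decr v}"

text \<open>\<open>k\<close> counts the zeros already placed, and \<open>v\<close> may begin with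
  more of them; a further zero then simply raises \<open>k\<close>.\<close>

definition continuations :: "nat \<Rightarrow> nat \<Rightarrow> nat list set" where
  "continuations k m = {v. length v = m \<and> weak_ascent_seq (replicate k 0 @ v) \<and>
                           avoids (replicate k 0 @ v) [0, 1, 2]}"

lemma finite_capped_words: "finite (capped_words a m)"
  by (rule finite_subset[OF _ finite_lists_length_eq[of "{..a}" m]])
    (auto simp: capped_words_def)

lemma capped_words_0: "capped_words a 0 = {[]}"
  by (auto simp: capped_words_def)

text \<open>A leading zero keeps the cap \<open>a\<close>, while a nonzero letter \<open>x\<close>
  lowers it to \<open>x\<close>.\<close>

lemma capped_words_Suc:
  "capped_words a (Suc m) =
     (#) 0 ` capped_words a m \<union> (\<Union>x\<in>{1..a}. (#) x ` capped_words x m)" (is "?L = ?R")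
proof (intro set_eqI)
  fix w :: "nat list"
  show "w \<in> ?L \<longleftrightarrow> w \<in> ?R"
    by (cases w; cases "hd w = 0") (auto simp: capped_words_def image_iff)
qed

lemma continuations_0:
  assumes "k > 0" shows "continuations k 0 = {[]}"
  using assms avoids_012_replicate_0_iff[of k "[]"]
  by (auto simp: continuations_def weak_ascent_seq_replicate_0)

lemma continuations_Suc:
  assumes "k > 0"
  shows "continuations k (Suc m) =
     (#) 0 ` continuations (Suc k) m \<union> (\<Union>x\<in>{1..k}. (#) x ` capped_words x m)" (is "?L = ?R")
proof (intro set_eqI)
  fix w :: "nat list"
  show "w \<in> ?L \<longleftrightarrow> w \<in> ?R"
  proof (cases w)
    case Nil
    then show ?thesis by (auto simp: continuations_def)
  next
    case (Cons x v)
    show ?thesis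
    proof (cases "x = 0")
      case True
      have "replicate (Suc k) 0 @ v = replicate k 0 @ 0 # v"
        by (simp add: replicate_app_Cons_same)
      then have "v \<in> continuations (Suc k) m \<longleftrightarrow> 0 # v \<in> ?L"
        unfolding continuations_def mem_Collect_eq by simp
      then show ?thesis
        using Cons True by auto
    next
      case False
      \<comment> \<open>Since \<open>x\<close> is nonzero, \<open>nonzero_decr (x # v)\<close> makes
        \<open>x\<close> a bound for all of \<open>v\<close>, so the growth condition reduces to
        \<open>x \<le> k\<close>.\<close>
      have "w \<in> ?L \<longleftrightarrow> length v = m \<and> weak_ascent_seq (replicate k 0 @ x # v) \<and>
              (\<forall>y\<in>set v. y \<le> x) \<and> nonzero_decr v"
        using Cons False assms by (auto simp: continuations_def avoids_012_replicate_0_iff simp del: One_nat_def)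
      also have "\<dots> \<longleftrightarrow> x \<le> k \<and> v \<in> capped_words x m"
        using weak_ascent_seq_replicate_0_Cons_iff[of k x v] False assms
        by (auto simp: capped_words_def)
      also have "\<dots> \<longleftrightarrow> w \<in> ?R"
        using Cons False by auto
      finally show ?thesis .
    qed
  qed
qed

lemma finite_continuations: "k > 0 \<Longrightarrow> finite (continuations k m)"
  by (induction m arbitrary: k)
    (auto simp: continuations_0 continuations_Suc finite_capped_words)

lemma card_first_letter:
  assumes "finite A" "\<And>x. finite (B x)"
  shows "card ((#) 0 ` A \<union> (\<Union>x\<in>{1..k}. (#) x ` B x)) = card A + (\<Sum>x=1..k::nat. card (B x))"
proof -
  have "card (\<Union>x\<in>{1..k}. (#) x ` B x) = (\<Sum>x=1..k. card ((#) x ` B x))"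
    by (rule card_UN_disjoint) (use assms in auto)
  moreover have "card ((#) 0 ` A \<union> (\<Union>x\<in>{1..k}. (#) x ` B x)) =
      card ((#) 0 ` A) + card (\<Union>x\<in>{1..k}. (#) x ` B x)"
    by (rule card_Un_disjoint) (use assms in auto)
  ultimately show ?thesis
    by (simp add: card_image)
qed

section \<open>Generating functions and their recurrences\<close>

definition capped_gf :: "nat \<Rightarrow> rat fps" where
  "capped_gf a = Abs_fps (\<lambda>m. of_nat (card (capped_words a m)))"

definition continuations_gf :: "nat \<Rightarrow> rat fps" where
  "continuations_gf k = Abs_fps (\<lambda>m. of_nat (card (continuations k m)))"

lemma capped_gf_eq:
  "capped_gf a = 1 + fps_X * (capped_gf a + (\<Sum>x=1..a. capped_gf x))" (is "_ = ?R")
proof (rule fps_ext)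
  show "fps_nth (capped_gf a) n = fps_nth ?R n" for n
    by (cases n) (auto simp: capped_gf_def capped_words_0 capped_words_Suc
        card_first_letter finite_capped_words fps_sum_nth
        simp del: One_nat_def)
qed

lemma continuations_gf_eq:
  assumes "k > 0"
  shows "continuations_gf k =
    1 + fps_X * (continuations_gf (Suc k) + (\<Sum>x=1..k. capped_gf x))" (is "_ = ?R")
proof (rule fps_ext)
  show "fps_nth (continuations_gf k) n = fps_nth ?R n" for n
    using assms by (cases n) (auto simp: continuations_gf_def capped_gf_def continuations_0
        continuations_Suc card_first_letter finite_capped_words finite_continuations fps_sum_nth
        simp del: One_nat_def)
qed

text \<open>In the difference of the equations for \<open>a\<close> and \<open>Suc a\<close>, only
  the last term of the longer sum survives.\<close>

lemma capped_gf_Suc: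
  "(1 - 2 * fps_X) * capped_gf (Suc a) = (1 - fps_X) * capped_gf a"
  using capped_gf_eq[of a] capped_gf_eq[of "Suc a"] by simp algebra

text \<open>A division-free form of \<open>D a = (1 - x)^(a-1) / (1 - 2x)^a\<close>; the extra
  factor \<open>1 - fps_X\<close> avoids a negative exponent at \<open>a = 0\<close>.\<close>

lemma capped_gf_closed: "(1 - 2 * fps_X) ^ a * (1 - fps_X) * capped_gf a = (1 - fps_X) ^ a"
proof (induction a)
  case 0
  show ?case using capped_gf_eq[of 0] by (simp add: algebra_simps)
next
  case (Suc a)
  have "(1 - 2 * fps_X) ^ Suc a * (1 - fps_X) * capped_gf (Suc a) =
      (1 - 2 * fps_X) ^ a * (1 - fps_X) * ((1 - 2 * fps_X) * capped_gf (Suc a))"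
    by (simp add: algebra_simps)
  also have "\<dots> = (1 - fps_X) * ((1 - 2 * fps_X) ^ a * (1 - fps_X) * capped_gf a)"
    unfolding capped_gf_Suc by (simp only: mult_ac)
  finally show ?case by (simp only: Suc power_Suc)
qed

text \<open>The equations for \<open>C k\<close> and \<open>D k\<close> contain the same sum, which
  cancels in their difference.\<close>

lemma continuations_gf_rec:
  "k > 0 \<Longrightarrow> continuations_gf k = fps_X * continuations_gf (Suc k) + (1 - fps_X) * capped_gf k"
  using continuations_gf_eq[of k] capped_gf_eq[of k] by algebra

text \<open>The recursion climbs in \<open>k\<close> without a base case, but the factor
  \<open>fps_X\<close> makes coefficient \<open>n\<close> of \<open>A k\<close> depend only on
  \<open>G k\<close> and coefficient \<open>n - 1\<close> of \<open>A (Suc k)\<close>. Induction on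
  \<open>n\<close>, for all \<open>k\<close> at once, settles it.\<close>

lemma fps_X_recurrence_unique:
  fixes A B G :: "nat \<Rightarrow> 'a::comm_ring_1 fps"
  assumes A: "\<And>k. k > 0 \<Longrightarrow> A k = fps_X * A (Suc k) + G k"
    and B: "\<And>k. k > 0 \<Longrightarrow> B k = fps_X * B (Suc k) + G k"
    and "k > 0"
  shows "A k = B k"
proof (rule fps_ext)
  show "fps_nth (A k) n = fps_nth (B k) n" for n
    using \<open>k > 0\<close>
  proof (induction n arbitrary: k)
    case 0
    then show ?case using arg_cong[OF A[of k], of "\<lambda>f. fps_nth f 0"]
        arg_cong[OF B[of k], of "\<lambda>f. fps_nth f 0"] by simp
  next
    case (Suc n)
    then show ?case using arg_cong[OF A[of k], of "\<lambda>f. fps_nth f (Suc n)"]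
        arg_cong[OF B[of k], of "\<lambda>f. fps_nth f (Suc n)"] Suc.IH[of "Suc k"] by simp
  qed
qed

lemma continuations_gf_1: "continuations_gf 1 = (1 - fps_X) / (1 - 3 * fps_X + fps_X ^ 2)"
proof -
  let ?P = "1 - 2 * fps_X :: rat fps" and ?Q = "1 - 3 * fps_X + fps_X ^ 2 :: rat fps"
  define r where "r = (1 - fps_X) * inverse ?P"
  \<comment> \<open>Since \<open>1 - fps_X * r = ?Q / ?P\<close>, this is the candidate solution
    \<open>r ^ k / (1 - fps_X * r)\<close>.\<close>
  define B where "B k = r ^ k * ?P * inverse ?Q" for k
  have P: "inverse ?P * ?P = 1" and Q: "inverse ?Q * ?Q = 1"
    by (rule inverse_mult_eq_1; simp)+
  have rP: "r * ?P = 1 - fps_X"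
    unfolding r_def using P by algebra
  have D: "(1 - fps_X) * capped_gf k = r ^ k" for k
  proof -
    have "r ^ k = inverse ?P ^ k * (?P ^ k * (1 - fps_X) * capped_gf k)"
      unfolding capped_gf_closed r_def by (simp add: power_mult_distrib mult.commute)
    also have "\<dots> = (inverse ?P * ?P) ^ k * ((1 - fps_X) * capped_gf k)"
      by (simp only: power_mult_distrib mult_ac)
    finally show ?thesis unfolding P by simp
  qed
  \<comment> \<open>This is \<open>1 = x r + (1 - x r)\<close> multiplied by \<open>?P\<close>; a
    further factor \<open>r ^ k * inverse ?Q\<close> turns it into the recurrence for
    \<open>B\<close>.\<close>
  have PQ: "?P = fps_X * (r * ?P) + ?Q"
    unfolding rP by (simp add: algebra_simps power2_eq_square)
  have splitting: "a * (x * (r * p) + q) * i = x * (r * a * p * i) + a * (i * q)"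
    for a x p q i :: "rat fps"
    by (simp add: algebra_simps)
  have B_rec: "B k = fps_X * B (Suc k) + (1 - fps_X) * capped_gf k" for k
  proof -
    have "B k = r ^ k * (fps_X * (r * ?P) + ?Q) * inverse ?Q"
      using arg_cong[OF PQ, of "\<lambda>p. r ^ k * p * inverse ?Q"] unfolding B_def .
    also have "\<dots> = fps_X * B (Suc k) + r ^ k * (inverse ?Q * ?Q)"
      unfolding B_def power_Suc by (rule splitting)
    finally show ?thesis by (simp only: Q D mult_1_right)
  qed
  have "continuations_gf 1 = B 1"
    by (rule fps_X_recurrence_unique[where G = "\<lambda>k. (1 - fps_X) * capped_gf k"])
      (erule continuations_gf_rec, rule B_rec, simp)
  also have "\<dots> = (1 - fps_X) * inverse ?Q"
    unfolding B_def using rP by simp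
  finally show ?thesis
    by (simp add: fps_divide_unit del: One_nat_def)
qed

section \<open>Return to all avoiding sequences\<close>

lemma num_avoiding_012_0: "num_avoiding [0, 1, 2] 0 = 1"
proof -
  have "avoiding_weak_ascent_seqs [0, 1, 2] 0 = {[]}"
    unfolding avoiding_weak_ascent_seqs_def avoids_def contains_012_iff
    by (auto simp: weak_ascent_seq_def)
  then show ?thesis by (simp add: num_avoiding_def)
qed

text \<open>A nonempty weak ascent sequence begins with 0; removing it leaves a continuation of a
  single zero.\<close>

lemma num_avoiding_012_Suc: "num_avoiding [0, 1, 2] (Suc n) = card (continuations 1 n)"
proof -
  have "avoiding_weak_ascent_seqs [0, 1, 2] (Suc n) = (#) 0 ` continuations 1 n"
  proof (intro set_eqI)
    fix w :: "nat list"
    show "w \<in> avoiding_weak_ascent_seqs [0, 1, 2] (Suc n) \<longleftrightarrow> w \<in> (#) 0 ` continuations 1 n"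
      by (cases w)
        (auto simp: avoiding_weak_ascent_seqs_def continuations_def weak_ascent_seq_def)
  qed
  then show ?thesis by (simp add: num_avoiding_def card_image)
qed

theorem theorem2p3:
  shows "gen_fun_avoiding [0, 1, 2] = (1 - 2 * fps_X) / (1 - 3 * fps_X + fps_X ^ 2)"
proof -
  let ?Q = "1 - 3 * fps_X + fps_X ^ 2 :: rat fps"
  have Q: "inverse ?Q * ?Q = 1"
    by (rule inverse_mult_eq_1) simp
  have "gen_fun_avoiding [0, 1, 2] = 1 + fps_X * continuations_gf 1"
  proof (rule fps_ext)
    show "fps_nth (gen_fun_avoiding [0, 1, 2]) n = fps_nth (1 + fps_X * continuations_gf 1) n" for n
      by (cases n) (simp_all only: gen_fun_avoiding_def continuations_gf_def fps_nth_Abs_fps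
          num_avoiding_012_0 num_avoiding_012_Suc, simp_all)
  qed
  also have "\<dots> = 1 + fps_X * ((1 - fps_X) * inverse ?Q)"
    by (simp add: continuations_gf_1 fps_divide_unit del: One_nat_def)
  \<comment> \<open>The numerators combine by
    \<open>?Q + fps_X * (1 - fps_X) = 1 - 2 * fps_X\<close>.\<close>
  also have "\<dots> = (1 - 2 * fps_X) * inverse ?Q"
    using Q by algebra
  finally show ?thesis
    by (simp add: fps_divide_unit)
qed

end
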